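(* Let $q$ be a prime, let $S \subseteq \mathbb{F}_q$, let $k \leq |S|/2$ be a positive integer, and let $H := H_q(k,S) \in \mathbb{F}_q^{k \times S}$. Then the lattice $\mathcal{L} = \mathcal{L}^{\perp}(H)$ has $\ell_1$ minimum distance $\lambda_1^{(1)}(\mathcal{L}) \geq 2k$. As a consequence, for every $p \in [1,\infty)$, $\lambda_1^{(p)}(\mathcal{L}) \geq (2k)^{1/p}$.
   Context: For a prime $q$, a positive integer $k$, and a set $S \subseteq \mathbb{F}_q$, $H_q(k,S) \in \mathbb{F}_q^{k \times S}$ is the matrix with rows indexed by $\{0,1,\ldots,k-1\}$ and columns indexed by $S$, whose $(i,s)$ entry is $s^i \in \mathbb{F}_q$ (with the convention $0^0 := 1$), i.e. a transposed Vandermonde matrix. For $H \in \mathbb{F}_q^{k \times S}$, the parity-check lattice is $\mathcal{L}^{\perp}(H) := \{\vec z \in \mathbb{Z}^S : H\vec z = \vec 0 \in \mathbb{F}_q^k\}$ (with $\vec z$ reduced mod $q$). For a lattice $\mathcal{L}$, $\lambda_1^{(p)}(\mathcal{L}) := \min_{\vec x \in \mathcal{L}\setminus\{\vec 0\}}\|\vec x\|_p$. *)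

theory Defs
  imports "HOL-Analysis.Analysis" "Berlekamp_Zassenhaus.Finite_Field"
begin

text \<open>
  The prime field with \<open>q\<close> elements is the type \<open>'q mod_ring\<close> with \<open>'q :: prime_card\<close>, where
  \<open>q = CARD('q)\<close> is prime by the class assumption. On this type \<open>of_int\<close> is reduction modulo \<open>q\<close>.

  A matrix with rows indexed by \<open>{0..<k}\<close> and columns indexed by \<open>S\<close>, and likewise a vector
  indexed by \<open>S\<close>, is a function that vanishes outside its index set.
\<close>

definition vandermonde_parity ::
    "nat \<Rightarrow> 'q::prime_card mod_ring set \<Rightarrow> nat \<Rightarrow> 'q mod_ring \<Rightarrow> 'q mod_ring" where
  "vandermonde_parity k S = (\<lambda>i s. if i < k \<and> s \<in> S then s ^ i else 0)"

definition parity_check_lattice ::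
    "nat \<Rightarrow> 's set \<Rightarrow> (nat \<Rightarrow> 's \<Rightarrow> 'q::prime_card mod_ring) \<Rightarrow> ('s \<Rightarrow> int) set" where
  "parity_check_lattice k S H =
     {z. (\<forall>s. s \<notin> S \<longrightarrow> z s = 0) \<and> (\<forall>i<k. (\<Sum>s\<in>S. H i s * of_int (z s)) = 0)}"

definition lp_norm :: "real \<Rightarrow> 's set \<Rightarrow> ('s \<Rightarrow> int) \<Rightarrow> real" where
  "lp_norm p S x = (\<Sum>s\<in>S. \<bar>real_of_int (x s)\<bar> powr p) powr (1 / p)"

text \<open>
  \<open>LEAST\<close> on the reals denotes the minimum when it is attained and is unspecified otherwise;
  the lemmas below show that it is attained for the lattices considered here.
\<close>

definition min_dist :: "real \<Rightarrow> 's set \<Rightarrow> ('s \<Rightarrow> int) set \<Rightarrow> real" where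
  "min_dist p S L = (LEAST r. \<exists>x \<in> L - {\<lambda>_. 0}. r = lp_norm p S x)"

lemma abs_le_lp_norm:
  assumes "finite S" "s \<in> S" "p \<ge> 1"
  shows "\<bar>real_of_int (x s)\<bar> \<le> lp_norm p S x"
proof -
  have "\<bar>real_of_int (x s)\<bar> = (\<bar>real_of_int (x s)\<bar> powr p) powr (1 / p)"
    using assms by (simp add: powr_powr)
  also have "\<dots> \<le> lp_norm p S x"
    unfolding lp_norm_def using assms
    by (intro powr_mono2 member_le_sum) auto
  finally show ?thesis .
qed

lemma min_dist_attained:
  assumes fin: "finite S" and p: "p \<ge> 1"
    and supp: "\<And>x s. x \<in> L \<Longrightarrow> s \<notin> S \<Longrightarrow> x s = 0"
    and ne: "L - {\<lambda>_. 0} \<noteq> {}"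
  shows "\<exists>x \<in> L - {\<lambda>_. 0}. min_dist p S L = lp_norm p S x"
    and "\<And>y. y \<in> L - {\<lambda>_. 0} \<Longrightarrow> min_dist p S L \<le> lp_norm p S y"
proof -
  let ?A = "L - {\<lambda>_. 0}"
  obtain x0 where x0: "x0 \<in> ?A" using ne by blast
  define R where "R = \<lceil>lp_norm p S x0\<rceil>"
  define B where "B = {x \<in> ?A. lp_norm p S x \<le> lp_norm p S x0}"
  have "B \<subseteq> {f. \<forall>s. (s \<in> S \<longrightarrow> f s \<in> {-R..R}) \<and> (s \<notin> S \<longrightarrow> f s = 0)}"
  proof (intro subsetI CollectI allI conjI impI)
    fix x s assume x: "x \<in> B"
    { assume "s \<in> S"
      then have "\<bar>real_of_int (x s)\<bar> \<le> lp_norm p S x0"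
        using abs_le_lp_norm[OF fin _ p, of s x] x unfolding B_def by fastforce
      then have "\<bar>x s\<bar> \<le> R" unfolding R_def by linarith
      then show "x s \<in> {-R..R}" by auto }
    { assume "s \<notin> S" then show "x s = 0" using x supp unfolding B_def by blast }
  qed
  then have "finite B"
    by (rule finite_subset) (rule finite_set_of_finite_funs[OF fin], simp)
  moreover have "x0 \<in> B" using x0 by (simp add: B_def)
  ultimately obtain m where m: "m \<in> B" "\<And>y. y \<in> B \<Longrightarrow> lp_norm p S m \<le> lp_norm p S y"
    by (metis arg_min_least arg_min_if_finite(1) empty_iff)
  have le: "lp_norm p S m \<le> lp_norm p S y" if "y \<in> ?A" for y
    using m that \<open>x0 \<in> B\<close> unfolding B_def by (cases "y \<in> B") (force simp: B_def)+
  have eq: "min_dist p S L = lp_norm p S m"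
    unfolding min_dist_def using m(1) le by (intro Least_equality) (auto simp: B_def)
  show "\<exists>x \<in> ?A. min_dist p S L = lp_norm p S x" using eq m(1) by (auto simp: B_def)
  show "min_dist p S L \<le> lp_norm p S y" if "y \<in> ?A" for y using eq le[OF that] by simp
qed

lemma parity_check_lattice_nontrivial:
  fixes H :: "nat \<Rightarrow> 's \<Rightarrow> 'q::prime_card mod_ring"
  assumes "S \<noteq> {}"
  shows "parity_check_lattice k S H - {\<lambda>_. 0} \<noteq> {}"
proof -
  obtain s where s: "s \<in> S" using assms by blast
  let ?z = "\<lambda>t. if t = s then int CARD('q) else 0"
  have c: "(of_nat CARD('q) :: 'q mod_ring) = 0"
    by (rule of_nat_card_eq_0)
  have "?z \<in> parity_check_lattice k S H"
    unfolding parity_check_lattice_def using s c by (auto intro!: sum.neutral)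
  moreover have "?z \<noteq> (\<lambda>_. 0)" by (auto simp: fun_eq_iff)
  ultimately show ?thesis by blast
qed

end

theory Submission
  imports Defs
begin

text \<open>
  A lattice vector of \<open>\<ell>\<^sub>1\<close> norm below \<open>2k\<close> has coordinate sum divisible by \<open>q\<close> and smaller
  than \<open>q\<close> in absolute value, hence zero, so its positive part \<open>a\<close> and its negative part \<open>b\<close> have
  the same mass \<open>m < k\<close>. Put \<open>f = \<Prod>(X - s)^(a s)\<close> and \<open>g = \<Prod>(X - s)^(b s)\<close>. The parity checks
  say that \<open>f'/f - g'/g = \<Sum>(a s - b s)/(X - s)\<close> vanishes at infinity to order above \<open>k\<close>, so
  \<open>f' g - f g'\<close> has degree below \<open>2m - k < m\<close>. If \<open>h = f - g\<close> were nonzero of degree \<open>d < m\<close>, then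
  \<open>f' g - f g' = h' g - h g'\<close> would have the coefficient \<open>(d - m) lc(h) \<noteq> 0\<close> at degree
  \<open>m + d - 1 \<ge> 2m - k\<close>. Hence \<open>f = g\<close>, although \<open>a\<close> and \<open>b\<close> have disjoint supports.
\<close>

hide_const (open) up_ring.coeff Module.smult

section \<open>Coefficients of products and of synthetic quotients\<close>

lemma coeff_mult_degree_bounds:
  fixes p q :: "'a::comm_semiring_1 poly"
  assumes "degree p \<le> a" "degree q \<le> b"
  shows "coeff (p * q) (a + b) = coeff p a * coeff q b"
proof -
  have "coeff p i * coeff q (a + b - i) = 0" if "i \<in> {..a + b} - {a}" for i
  proof (cases "i < a")
    case True
    then have "degree q < a + b - i" using assms by linarith
    then show ?thesis by (simp add: coeff_eq_0)
  next
    case False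
    then have "degree p < i" using that assms by auto
    then show ?thesis by (simp add: coeff_eq_0)
  qed
  then have "(\<Sum>i\<le>a + b. coeff p i * coeff q (a + b - i)) =
      (\<Sum>i\<in>{a}. coeff p i * coeff q (a + b - i))"
    by (intro sum.mono_neutral_right) auto
  then show ?thesis by (simp add: coeff_mult)
qed

text \<open>The coefficient at \<open>j\<close> of (P - P(s))/(X - s) is a polynomial in
  \<open>s\<close> of degree at most \<open>degree P - j - 1\<close>, so only power sums with
  exponent below \<open>k\<close> occur. The shift \<open>i\<close> is there for the induction:
  Horner's recurrence raises \<open>i\<close> and \<open>j\<close> together.\<close>

lemma coeff_sum_synthetic_div_eq_0:
  fixes w :: "'a::idom \<Rightarrow> 'a"
  assumes moments: "\<And>i. i < k \<Longrightarrow> (\<Sum>s\<in>S. w s * s ^ i) = 0"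
    and "degree P \<le> j + k - i" "i \<le> k"
  shows "(\<Sum>s\<in>S. w s * s ^ i * coeff (synthetic_div P s) j) = 0"
  using assms(2,3)
proof (induction "degree P - j" arbitrary: i j)
  case 0
  have "coeff (synthetic_div P s) j = 0" for s
  proof (cases "degree P = 0")
    case True
    then show ?thesis
      by (metis coeff_0 synthetic_div_eq_0_iff)
  next
    case False
    then show ?thesis using 0 by (intro coeff_eq_0) (simp add: degree_synthetic_div)
  qed
  then show ?case by simp
next
  case (Suc d)
  have rec: "coeff (synthetic_div P s) j =
      coeff P (Suc j) + s * coeff (synthetic_div P s) (Suc j)" for s
  proof -
    have "coeff (P + smult s (synthetic_div P s)) (Suc j) =
        coeff (pCons (poly P s) (synthetic_div P s)) (Suc j)"
      by (simp only: synthetic_div_correct)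
    then show ?thesis by simp
  qed
  have "(\<Sum>s\<in>S. w s * s ^ i * coeff (synthetic_div P s) j) =
      coeff P (Suc j) * (\<Sum>s\<in>S. w s * s ^ i) +
      (\<Sum>s\<in>S. w s * s ^ Suc i * coeff (synthetic_div P s) (Suc j))"
    by (simp add: rec sum_distrib_left sum.distrib[symmetric] algebra_simps)
  \<comment> \<open>Here \<open>i < k\<close>, because \<open>j < degree P\<close> and
    \<open>degree P \<le> j + k - i\<close>.\<close>
  also have "(\<Sum>s\<in>S. w s * s ^ i) = 0"
    using Suc by (intro moments) linarith
  also have "(\<Sum>s\<in>S. w s * s ^ Suc i * coeff (synthetic_div P s) (Suc j)) = 0"
    using Suc by (intro Suc.hyps(1)) linarith+
  finally show ?case by simp
qed

section \<open>Products of powers of linear factors\<close>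

lemma synthetic_div_mult_linear:
  fixes p :: "'a::idom poly"
  shows "synthetic_div ([:- c, 1:] * p) c = p"
proof -
  have "[:- c, 1:] * synthetic_div ([:- c, 1:] * p) c = [:- c, 1:] * p"
    using synthetic_div_correct'[of c "[:- c, 1:] * p"] by simp
  moreover have "[:- c, 1:] \<noteq> 0" by simp
  ultimately show ?thesis using mult_left_cancel by blast
qed

text \<open>This is f'/f = sum of a(s)/(X - s), cleared of denominators by the factor
  \<open>f * g\<close>. The division by X - s is exact if \<open>a s > 0\<close>, and otherwise the
  term has coefficient zero.\<close>

lemma pderiv_prod_linear_powers_mult:
  fixes a :: "'a::field \<Rightarrow> nat"
  assumes "finite S"
  defines "f \<equiv> \<Prod>s\<in>S. [:- s, 1:] ^ a s"
  shows "pderiv f * g = (\<Sum>s\<in>S. smult (of_nat (a s)) (synthetic_div (f * g) s))"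
proof -
  have "(\<Prod>u\<in>S - {s}. [:- u, 1:] ^ a u) * pderiv ([:- s, 1:] ^ a s) * g =
      smult (of_nat (a s)) (synthetic_div (f * g) s)" if "s \<in> S" for s
  proof (cases "a s")
    case 0
    then show ?thesis by simp
  next
    case (Suc n)
    define r where "r = (\<Prod>u\<in>S - {s}. [:- u, 1:] ^ a u)"
    have "f = [:- s, 1:] ^ a s * r"
      unfolding f_def r_def using assms that by (simp add: prod.remove)
    then have "f * g = [:- s, 1:] * ([:- s, 1:] ^ n * r * g)"
      by (simp only: Suc power_Suc mult.assoc)
    then have "synthetic_div (f * g) s = [:- s, 1:] ^ n * r * g"
      by (simp only: synthetic_div_mult_linear)
    moreover have "pderiv ([:- s, 1:] ^ a s) = smult (of_nat (a s)) ([:- s, 1:] ^ n)"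
      unfolding Suc pderiv_power_Suc by (simp add: pderiv_pCons)
    ultimately show ?thesis
      by (simp add: r_def[symmetric] mult_ac)
  qed
  then show ?thesis
    unfolding f_def pderiv_prod sum_distrib_right by (intro sum.cong) (auto simp: f_def)
qed

lemma degree_prod_linear_powers:
  fixes a :: "'a::field \<Rightarrow> nat"
  shows "degree (\<Prod>s\<in>S. [:- s, 1:] ^ a s) = (\<Sum>s\<in>S. a s)"
  by (subst degree_prod_eq_sum_degree) (auto simp: degree_power_eq)

lemma poly_prod_linear_powers_eq_0_iff:
  fixes a :: "'a::field \<Rightarrow> nat"
  assumes "finite S" "s \<in> S"
  shows "poly (\<Prod>u\<in>S. [:- u, 1:] ^ a u) s = 0 \<longleftrightarrow> a s > 0"
  using assms by (auto simp: poly_prod)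

section \<open>Wronskians and power sums\<close>

lemma monic_eq_if_wronskian_small:
  fixes f g :: "'a::field poly"
  assumes deg: "degree f = m" "degree g = m" and monic: "monic f" "monic g"
    and char: "\<And>n. 0 < n \<Longrightarrow> n \<le> m \<Longrightarrow> of_nat n \<noteq> (0::'a)"
    and wronskian: "\<And>j. m \<le> Suc j \<Longrightarrow> coeff (pderiv f * g - f * pderiv g) j = 0"
  shows "f = g"
proof (rule ccontr)
  assume "f \<noteq> g"
  define h where "h = f - g"
  define d where "d = degree h"
  have "h \<noteq> 0" using \<open>f \<noteq> g\<close> by (simp add: h_def)
  have "coeff h m = 0" using deg monic by (simp add: h_def)
  moreover have "d \<le> m" using degree_diff_le_max[of f g] deg by (simp add: h_def d_def)
  ultimately have "d < m" using \<open>h \<noteq> 0\<close> unfolding d_def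
    by (metis leading_coeff_0_iff le_neq_implies_less)
  \<comment> \<open>The Euler operator X d/dX scales each coefficient by its index and, unlike
    \<open>pderiv\<close>, does not shift it.\<close>
  define theta :: "'a poly \<Rightarrow> 'a poly" where "theta p = pCons 0 (pderiv p)" for p
  have coeff_theta: "coeff (theta p) n = of_nat n * coeff p n" for p n
    by (cases n) (simp_all add: theta_def coeff_pderiv)
  have deg_theta: "degree (theta p) \<le> degree p" for p
    by (intro degree_le) (simp add: coeff_theta coeff_eq_0)
  \<comment> \<open>Passing from \<open>f\<close> to \<open>h\<close> changes nothing, since the
    Wronskian of \<open>g\<close> with itself is zero.\<close>
  have "theta h * g - h * theta g = pCons 0 (pderiv f * g - f * pderiv g)"
    by (simp add: theta_def h_def pderiv_diff algebra_simps)
  moreover have "coeff (pCons 0 (pderiv f * g - f * pderiv g)) (d + m) = 0"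
    using wronskian[of "d + m - 1"] \<open>d < m\<close> by (cases "d + m") simp_all
  ultimately have "coeff (theta h * g) (d + m) - coeff (h * theta g) (d + m) = 0"
    by (metis coeff_diff)
  moreover have "coeff (theta h * g) (d + m) = of_nat d * coeff h d"
    using deg monic deg_theta[of h]
    by (subst coeff_mult_degree_bounds) (auto simp: d_def coeff_theta)
  moreover have "coeff (h * theta g) (d + m) = of_nat m * coeff h d"
    using deg monic deg_theta[of g]
    by (subst coeff_mult_degree_bounds) (auto simp: d_def coeff_theta)
  ultimately have "of_nat (m - d) * coeff h d = 0"
    using \<open>d < m\<close> by (simp add: of_nat_diff algebra_simps)
  moreover have "coeff h d \<noteq> 0" using \<open>h \<noteq> 0\<close> by (simp add: d_def)
  ultimately show False using char[of "m - d"] \<open>d < m\<close> by simp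
qed

text \<open>Newton's identities would also determine \<open>f\<close> and \<open>g\<close> from
  these power sums; the Wronskian does it here. Once \<open>f = g\<close>, their common roots in
  \<open>S\<close> give both supports.\<close>

lemma equal_power_sums_imp_equal_support:
  fixes a b :: "'a::field \<Rightarrow> nat"
  assumes fin: "finite S" and mass: "(\<Sum>s\<in>S. a s) = m" "(\<Sum>s\<in>S. b s) = m" and "m < k"
    and char: "\<And>n. 0 < n \<Longrightarrow> n \<le> m \<Longrightarrow> of_nat n \<noteq> (0::'a)"
    and moments: "\<And>i. i < k \<Longrightarrow> (\<Sum>s\<in>S. (of_nat (a s) - of_nat (b s)) * s ^ i) = 0"
    and "s \<in> S"
  shows "a s > 0 \<longleftrightarrow> b s > 0"
proof -
  define f where "f = (\<Prod>s\<in>S. [:- s, 1:] ^ a s)"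
  define g where "g = (\<Prod>s\<in>S. [:- s, 1:] ^ b s)"
  have deg: "degree f = m" "degree g = m"
    unfolding f_def g_def degree_prod_linear_powers mass by simp_all
  have monic: "monic f" "monic g"
    unfolding f_def g_def by (auto intro!: monic_prod monic_power)
  have "degree (f * g) \<le> m + m" using degree_mult_le[of f g] deg by simp
  have wronskian: "pderiv f * g - f * pderiv g =
      (\<Sum>s\<in>S. smult (of_nat (a s) - of_nat (b s)) (synthetic_div (f * g) s))"
    using pderiv_prod_linear_powers_mult[OF fin, of a g, folded f_def]
      pderiv_prod_linear_powers_mult[OF fin, of b f, folded g_def]
    by (simp add: mult.commute smult_diff_left sum_subtractf)
  have "f = g"
  proof (rule monic_eq_if_wronskian_small[OF deg monic char])
    fix j assume "m \<le> Suc j"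
    \<comment> \<open>As \<open>j\<close> may be \<open>m - 1\<close>, the strict bound
      \<open>m < k\<close> is what gives \<open>2 * m \<le> j + k\<close>.\<close>
    then have "degree (f * g) \<le> j + k - 0"
      using \<open>degree (f * g) \<le> m + m\<close> \<open>m < k\<close> by linarith
    from coeff_sum_synthetic_div_eq_0[OF moments this]
    show "coeff (pderiv f * g - f * pderiv g) j = 0"
      unfolding wronskian by (simp add: coeff_sum)
  qed
  then show ?thesis
    using poly_prod_linear_powers_eq_0_iff[OF fin \<open>s \<in> S\<close>, of a]
      poly_prod_linear_powers_eq_0_iff[OF fin \<open>s \<in> S\<close>, of b]
    by (simp add: f_def g_def)
qed

section \<open>From lattice vectors to power sums\<close>

lemma of_int_mod_ring_eq_0_imp_dvd:
  assumes "of_int x = (0 :: 'q::prime_card mod_ring)"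
  shows "int CARD('q) dvd x"
proof -
  have "of_nat (nat \<bar>x\<bar>) = (0 :: 'q mod_ring)"
    using assms by (cases "x \<ge> 0") simp_all
  then show ?thesis
    using of_nat_0_mod_ring_dvd[of "nat \<bar>x\<bar>"] by simp
qed

lemma vandermonde_lattice_l1_ge:
  fixes S :: "'q::prime_card mod_ring set"
  assumes "k > 0" and kS: "2 * k \<le> card S"
    and z: "z \<in> parity_check_lattice k S (vandermonde_parity k S)" and "z \<noteq> (\<lambda>_. 0)"
  shows "(\<Sum>s\<in>S. \<bar>z s\<bar>) \<ge> 2 * int k"
proof (rule ccontr)
  assume "\<not> ?thesis"
  then have small: "(\<Sum>s\<in>S. \<bar>z s\<bar>) < 2 * int k" by simp
  have fin: "finite S" by simp
  \<comment> \<open>The resulting bound \<open>kq\<close> serves twice: to force the coordinate sum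
    to be zero, and to keep the mass below the characteristic.\<close>
  have "card S \<le> CARD('q)"
    using card_mono[of "UNIV :: 'q mod_ring set" S] by simp
  then have kq: "2 * k \<le> CARD('q)" using kS by simp
  have moments: "(\<Sum>s\<in>S. of_int (z s) * s ^ i) = 0" if "i < k" for i
    using z that unfolding parity_check_lattice_def vandermonde_parity_def
    by (auto simp: mult.commute)
  \<comment> \<open>Row \<open>0\<close> of the matrix consists of ones, also at
    \<open>s = 0\<close>.\<close>
  have "of_int (\<Sum>s\<in>S. z s) = (0 :: 'q mod_ring)"
    using moments[OF \<open>k > 0\<close>] by simp
  then have dvd: "int CARD('q) dvd (\<Sum>s\<in>S. z s)"
    by (rule of_int_mod_ring_eq_0_imp_dvd)
  have "\<bar>\<Sum>s\<in>S. z s\<bar> < int CARD('q)"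
    using sum_abs[of z S] small kq by linarith
  with dvd have sum0: "(\<Sum>s\<in>S. z s) = 0"
    using dvd_imp_le_int[of "\<Sum>s\<in>S. z s" "int CARD('q)"] by linarith
  define a b where "a s = nat (z s)" and "b s = nat (- z s)" for s
  have ab: "z s = int (a s) - int (b s)" "\<bar>z s\<bar> = int (a s) + int (b s)" for s
    by (simp_all add: a_def b_def)
  have mass: "(\<Sum>s\<in>S. a s) = (\<Sum>s\<in>S. b s)"
    using sum0 by (simp add: ab(1) sum_subtractf flip: of_nat_sum)
  have "int (\<Sum>s\<in>S. a s) + int (\<Sum>s\<in>S. b s) < 2 * int k"
    using small by (simp add: ab(2) sum.distrib)
  then have less: "(\<Sum>s\<in>S. a s) < k" using mass by linarith
  obtain s where "z s \<noteq> 0" using \<open>z \<noteq> (\<lambda>_. 0)\<close> by auto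
  then have "s \<in> S" using z by (auto simp: parity_check_lattice_def)
  have "a s > 0 \<longleftrightarrow> b s > 0"
  proof (rule equal_power_sums_imp_equal_support[OF fin refl mass[symmetric] less _ _ \<open>s \<in> S\<close>])
    fix n :: nat assume "0 < n" "n \<le> (\<Sum>s\<in>S. a s)"
    then have "\<not> CARD('q) dvd n"
      using less kq by (auto dest!: dvd_imp_le)
    then show "of_nat n \<noteq> (0 :: 'q mod_ring)"
      using of_nat_0_mod_ring_dvd by blast
  next
    fix i assume "i < k"
    then show "(\<Sum>s\<in>S. (of_nat (a s) - of_nat (b s)) * s ^ i) = 0"
      using moments by (simp add: ab(1))
  qed
  then show False using \<open>z s \<noteq> 0\<close> by (auto simp: a_def b_def)
qed

text \<open>A nonzero integer has absolute value at least 1, so raising to the power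
  \<open>p\<close> does not decrease it.\<close>

lemma lp_norm_ge_l1_powr:
  assumes "p \<ge> 1"
  shows "real_of_int (\<Sum>s\<in>S. \<bar>x s\<bar>) powr (1 / p) \<le> lp_norm p S x"
proof -
  have "\<bar>real_of_int (x s)\<bar> \<le> \<bar>real_of_int (x s)\<bar> powr p" for s
  proof (cases "x s = 0")
    case False
    then have "\<bar>real_of_int (x s)\<bar> \<ge> 1" by linarith
    from powr_mono[OF assms this] show ?thesis by simp
  qed simp
  then show ?thesis
    unfolding lp_norm_def using assms
    by (intro powr_mono2) (auto intro!: sum_mono sum_nonneg)
qed

theorem theorem4p1:
  fixes S :: "'q::prime_card mod_ring set" and k :: nat
    and H :: "nat \<Rightarrow> 'q mod_ring \<Rightarrow> 'q mod_ring"
    and L :: "('q mod_ring \<Rightarrow> int) set"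
  assumes "k > 0" and "real k \<le> real (card S) / 2"
    and "H = vandermonde_parity k S"
    and "L = parity_check_lattice k S H"
  shows "min_dist 1 S L \<ge> 2 * real k \<and>
         (\<forall>p::real. p \<ge> 1 \<longrightarrow> min_dist p S L \<ge> (2 * real k) powr (1 / p))"
proof -
  have kS: "2 * k \<le> card S" using assms(2) by linarith
  then have "S \<noteq> {}" using \<open>k > 0\<close> by auto
  have main: "min_dist p S L \<ge> (2 * real k) powr (1 / p)" if "p \<ge> 1" for p
  proof -
    \<comment> \<open>Without a nonzero lattice vector the \<open>LEAST\<close> in
      \<open>min_dist\<close> would be unspecified.\<close>
    have "L - {\<lambda>_. 0} \<noteq> {}"
      unfolding assms(4) by (rule parity_check_lattice_nontrivial[OF \<open>S \<noteq> {}\<close>])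
    moreover have "x s = 0" if "x \<in> L" "s \<notin> S" for x s
      using that by (simp add: assms(4) parity_check_lattice_def)
    ultimately obtain x where x: "x \<in> L - {\<lambda>_. 0}" "min_dist p S L = lp_norm p S x"
      using min_dist_attained(1)[of S p L] \<open>p \<ge> 1\<close> by auto
    have "(\<Sum>s\<in>S. \<bar>x s\<bar>) \<ge> 2 * int k"
      using x(1) by (intro vandermonde_lattice_l1_ge[OF \<open>k > 0\<close> kS]) (auto simp: assms)
    then have "2 * real k \<le> real_of_int (\<Sum>s\<in>S. \<bar>x s\<bar>)" by linarith
    then have "(2 * real k) powr (1 / p) \<le> real_of_int (\<Sum>s\<in>S. \<bar>x s\<bar>) powr (1 / p)"
      using \<open>p \<ge> 1\<close> by (intro powr_mono2) auto
    also have "\<dots> \<le> lp_norm p S x" by (rule lp_norm_ge_l1_powr[OF \<open>p \<ge> 1\<close>])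
    finally show ?thesis using x(2) by simp
  qed
  then show ?thesis using main[of 1] by simp
qed

end
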